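(* If $k$ is even, then a bicycle $(4k,k)$-gon is regular. If $k$ is odd, then the even vertices of a bicycle $(4k,k)$-gon are equally spaced on a circle and its odd vertices are equally spaced on a concentric circle; that is, the polygon is obtained from a regular $2k$-gon by inserting, between each two consecutive vertices, a new vertex on the perpendicular bisector of the corresponding side, at the same signed distance $h$ from that side (where $h$ is a parameter of the construction).
   Context: Polygons are in the plane. A bicycle $(n,k)$-gon is an equilateral $n$-gon whose $k$-diagonals have equal length. More precisely, if the polygon is $V_1V_2\dots V_n$, it is required that $V_iV_{i+1}V_{i+k+1}V_{i+k}$ be a Darboux butterfly for all $i$, with indices understood cyclically (modulo $n$). A Darboux butterfly is the closed quadrilateral $ABDC$ made of the lateral sides $AB$, $CD$ and the diagonals $BD$, $AC$ of a plane isosceles trapezoid $ABCD$. The even (odd) vertices of $V_1V_2\dots V_{4k}$ are the vertices $V_i$ with $i$ even (odd).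
   Formalization: The vertices of the polygon are assumed pairwise distinct (with repeated vertices the claim fails, e.g. k = 1 with vertices 1, 0, i, 0), and "regular" includes regular star polygons, which are also bicycle (4k,k)-gons. *)

theory Defs
  imports "HOL-Analysis.Analysis"
begin

text \<open>
  The plane is \<^typ>\<open>complex\<close>. A polygon with \<open>n\<close> vertices is an \<open>n\<close>-periodic family indexed by the
  integers, so that indices are cyclic. The \<open>n\<close> vertices are pairwise distinct, but the polygon may
  be non-convex or self-intersecting. Distinctness matters: tracing a non-regular bicycle
  \<open>(2k,k)\<close>-gon (such polygons exist, for instance with \<open>k = 6\<close>) twice would otherwise be a
  non-regular bicycle \<open>(4k,k)\<close>-gon.
\<close>

definition polygon :: "nat \<Rightarrow> (int \<Rightarrow> complex) \<Rightarrow> bool" where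
  "polygon n V \<longleftrightarrow> (\<forall>i. V (i + int n) = V i) \<and> inj_on V {0..<int n}"

text \<open>Reflection in the line through \<open>a\<close> with direction \<open>u\<close>, where \<open>norm u = 1\<close>.\<close>

definition line_reflection :: "complex \<Rightarrow> complex \<Rightarrow> complex \<Rightarrow> complex" where
  "line_reflection a u z = a + u\<^sup>2 * cnj (z - a)"

text \<open>
  \<open>A B C D\<close> has bases \<open>AD\<close>, \<open>BC\<close> and is symmetric in the common perpendicular bisector of its bases.
  Degenerate cases are admitted: a base may shrink to a point (as it does for bicycle
  \<open>(n,1)\<close>-gons, where \<open>B = C\<close>), and the four points may be collinear. Nothing is said about which of
  the equal pairs \<open>AB, CD\<close> and \<open>AC, BD\<close> is the longer one, because a closed quadrilateral
  \<open>ABDC\<close> may also be read starting from \<open>B\<close>, which exchanges lateral sides and diagonals.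
\<close>

definition isosceles_trapezoid :: "complex \<Rightarrow> complex \<Rightarrow> complex \<Rightarrow> complex \<Rightarrow> bool" where
  "isosceles_trapezoid A B C D \<longleftrightarrow>
     (\<exists>a u. norm u = 1 \<and> line_reflection a u A = D \<and> line_reflection a u B = C)"

text \<open>The arguments are the consecutive vertices of the closed quadrilateral \<open>ABDC\<close>.\<close>

definition darboux_butterfly :: "complex \<Rightarrow> complex \<Rightarrow> complex \<Rightarrow> complex \<Rightarrow> bool" where
  "darboux_butterfly A B D C \<longleftrightarrow> isosceles_trapezoid A B C D"

definition bicycle_polygon :: "nat \<Rightarrow> nat \<Rightarrow> (int \<Rightarrow> complex) \<Rightarrow> bool" where
  "bicycle_polygon n k V \<longleftrightarrow>
     polygon n V \<and>
     (\<forall>i j. dist (V i) (V (i + 1)) = dist (V j) (V (j + 1))) \<and>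
     (\<forall>i j. dist (V i) (V (i + int k)) = dist (V j) (V (j + int k))) \<and>
     (\<forall>i. darboux_butterfly (V i) (V (i + 1)) (V (i + int k + 1)) (V (i + int k)))"

text \<open>
  Regular polygons, convex (\<open>m\<close> congruent to \<open>1\<close> or \<open>-1\<close> modulo \<open>n\<close>) or star-shaped, traversed in
  either direction. Star polygons must be included, since they are bicycle \<open>(n,k)\<close>-gons, too. As \<open>m\<close>
  is coprime to \<open>n\<close>, the \<open>n\<close> vertices are distinct. The case \<open>n = 2\<close> is a segment traversed twice.
\<close>

definition regular_polygon :: "nat \<Rightarrow> (int \<Rightarrow> complex) \<Rightarrow> bool" where
  "regular_polygon n V \<longleftrightarrow>
     (\<exists>(c::complex) (r::real) (\<theta>::real) (m::int). r > 0 \<and> coprime m (int n) \<and>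
        (\<forall>i. V i = c + of_real r * cis (\<theta> + 2 * pi * of_int m * of_int i / of_nat n)))"

definition equally_spaced_on_circle :: "nat \<Rightarrow> complex \<Rightarrow> real \<Rightarrow> complex set \<Rightarrow> bool" where
  "equally_spaced_on_circle N c r S \<longleftrightarrow>
     r > 0 \<and>
     (\<exists>\<theta>::real. S = (\<lambda>j::nat. c + of_real r * cis (\<theta> + 2 * pi * of_nat j / of_nat N)) ` {..<N})"

text \<open>
  Between \<open>U j\<close> and \<open>U (j + 1)\<close> insert the point of the perpendicular bisector at signed distance \<open>h\<close>
  from the side, positive to the left of the side directed from \<open>U j\<close> to \<open>U (j + 1)\<close>.
\<close>

definition obtained_by_insertion :: "(int \<Rightarrow> complex) \<Rightarrow> real \<Rightarrow> (int \<Rightarrow> complex) \<Rightarrow> bool" where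
  "obtained_by_insertion U h V \<longleftrightarrow>
     (\<forall>j. V (2 * j) = U j \<and>
          V (2 * j + 1) = midpoint (U j) (U (j + 1)) + of_real h * (\<i> * sgn (U (j + 1) - U j)))"

end

theory Submission
  imports Defs
begin

text \<open>
  Write \<open>a i = V (i + k) - V i\<close> for the diagonals and \<open>s i = V (i + 1) - V i\<close> for the sides, of
  lengths \<open>R\<close> and \<open>l\<close>. As \<open>n = 4 * k\<close>, the points \<open>V i\<close>, \<open>V (i + k)\<close>, \<open>V (i + 2 * k)\<close>, \<open>V (i + 3 * k)\<close> are
  distinct and form a closed quadrilateral with four sides of length \<open>R\<close>, that is, a rhombus. The
  vertices of the polygon therefore form a rhombus moving in discrete time \<open>i\<close>, whose opposite sides
  satisfy \<open>a (i + 2 * k) = - a i\<close>.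

  A butterfly is an equality of products: its axis has some direction \<open>u\<close>, the reflection gives both
  \<open>s i * s (i + k) = - (u * l)\<^sup>2\<close> and \<open>a i * a (i + 1) = - (u * R)\<^sup>2\<close>, and eliminating \<open>u\<close> leaves
  \<open>R\<^sup>2 * s i * s (i + k) = l\<^sup>2 * a i * a (i + 1)\<close> (\<open>darboux_butterfly_products\<close>). Applied to the four
  sides of the moving rhombus, these products force \<open>s (i + 2 * k) = - s i\<close>: the only alternative is
  that the rhombus moves by a translation, and then it would be flat (\<open>rhombus_center_step\<close>).
  Consequently opposite vertices of the rhombus move oppositely and its center \<open>c\<close> never moves
  (\<open>bicycle_polygon_central_symmetry\<close>).

  With \<open>W i = V i - c\<close>, the products for two adjacent sides of the rhombus add up to
  \<open>W (i + k) * W (i + 1 + k) = - W i * W (i + 1)\<close>, while half the diagonals of the rhombus and its side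
  satisfy \<open>(norm (W i))\<^sup>2 + (norm (W (i + k)))\<^sup>2 = R\<^sup>2\<close>. Together these give
  \<open>(norm (W i))\<^sup>2 + (norm (W (i + 1)))\<^sup>2 = R\<^sup>2\<close>, so the radii alternate between two values. If \<open>k\<close> is
  even, \<open>W i\<close> and \<open>W (i + k)\<close> have the same radius, hence all radii agree
  (\<open>bicycle_polygon_centered_relations\<close>).

  Finally \<open>W i\<close> and \<open>W (i + 2)\<close> are different, equally far from the center and equally far from
  \<open>W (i + 1)\<close>. They are thus mirror images in the line from the center to \<open>W (i + 1)\<close>, so that the
  polygon turns by the same angle \<open>\<delta>\<close> around \<open>c\<close> at every step. Closing up after \<open>4 * k\<close> steps
  makes \<open>\<delta>\<close> a multiple \<open>2 * pi * m / (4 * k)\<close>, and distinctness of the vertices makes \<open>m\<close> coprime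
  to \<open>4 * k\<close> if there is one radius, and to \<open>2 * k\<close> if there are two. This is the explicit form of the polygon from which all claims can be read off.
\<close>

section \<open>Plane geometry in complex coordinates\<close>

text \<open>
  For \<open>z \<noteq> 0\<close>, the points \<open>x\<close> and \<open>y\<close> lie on two circles with different centers \<open>0\<close> and \<open>z\<close>, which meet
  in at most two points, symmetric in the line through the centers. In the conclusion, this symmetry is written as a
  product so that it also holds for \<open>z = 0\<close> and so that it compares the angle from \<open>x\<close> to \<open>z\<close> with
  the one from \<open>z\<close> to \<open>y\<close>.
\<close>

lemma mirror_image_if_equidistant:
  fixes x y z :: complex
  assumes norms: "norm x = norm y" and dists: "norm (x - z) = norm (y - z)" and "x \<noteq> y"
  shows "y * cnj z = z * cnj x"
proof (cases "z = 0")
  case False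
  define P where "P = x * cnj z"
  define Q where "Q = y * cnj z"
  have "norm P = norm Q"
    using norms by (simp add: P_def Q_def norm_mult)
  then have sq: "(Re P)\<^sup>2 + (Im P)\<^sup>2 = (Re Q)\<^sup>2 + (Im Q)\<^sup>2"
    by (metis cmod_power2)
  have expand: "(norm (w - z))\<^sup>2 = (norm w)\<^sup>2 + (norm z)\<^sup>2 - 2 * Re (w * cnj z)" for w
    unfolding cmod_power2 by (simp add: power2_eq_square algebra_simps)
  \<comment> \<open>Equal distances to \<open>z\<close> and \<open>0\<close> mean equal projections onto the direction of \<open>z\<close>.\<close>
  have re: "Re P = Re Q"
    using expand[of x] expand[of y] norms dists by (simp add: P_def Q_def)
  have "P \<noteq> Q"
    using False \<open>x \<noteq> y\<close> by (simp add: P_def Q_def)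
  then have "Im P = - Im Q"
    using sq re by (auto simp: complex_eq_iff power2_eq_iff)
  then have "Q = cnj P"
    using re by (simp add: complex_eq_iff)
  then show ?thesis
    by (simp add: P_def Q_def mult.commute)
qed simp

text \<open>
  The vertices \<open>B\<close> and \<open>D\<close> are equidistant from \<open>A\<close> and from \<open>C\<close>, so they are mirror images in the line
  \<open>AC\<close>; as \<open>B\<close> is itself equidistant from \<open>A\<close> and \<open>C\<close>, its projection to that line is the midpoint. The
  inequalities exclude quadrilaterals in which a side is traversed back and forth.
\<close>

lemma rhombus_is_parallelogram:
  fixes A B C D :: complex
  assumes "norm (B - A) = \<rho>" "norm (C - B) = \<rho>" "norm (D - C) = \<rho>" "norm (A - D) = \<rho>"
    and "A \<noteq> C" "B \<noteq> D"
  shows "A + C = B + D"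
proof -
  define p q d where "p = B - A" and "q = D - A" and "d = C - A"
  have mirror: "q * cnj d = d * cnj p"
  proof (rule mirror_image_if_equidistant)
    show "norm p = norm q" "norm (p - d) = norm (q - d)"
      using assms by (simp_all add: p_def q_def d_def norm_minus_commute)
    show "p \<noteq> q"
      using assms by (simp add: p_def q_def)
  qed
  have "norm (p - d) = norm p"
    using assms by (simp add: p_def d_def norm_minus_commute)
  then have "(p - d) * cnj (p - d) = p * cnj p"
    by (simp only: complex_norm_square[symmetric])
  then have "(q + p) * cnj d = d * cnj d"
    using mirror by (simp add: algebra_simps)
  then have "q + p = d"
    using \<open>A \<noteq> C\<close> by (simp add: d_def)
  then show ?thesis
    by (simp add: p_def q_def d_def algebra_simps)
qed

text \<open>
  The reflection, whose linear part is \<open>z \<mapsto> u\<^sup>2 * cnj z\<close>, exchanges the lateral sides, and it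
  exchanges the diagonals of the trapezoid. Multiplying a segment by its mirror image gives \<open>u\<^sup>2\<close> times
  the squared length, and the equation results from eliminating \<open>u\<close>.
\<close>

lemma darboux_butterfly_products:
  assumes "darboux_butterfly A B D C"
  shows "(B - A) * (D - C) * of_real ((norm (C - A))\<^sup>2)
       = (C - A) * (D - B) * of_real ((norm (B - A))\<^sup>2)"
proof -
  obtain a u where u: "norm u = 1"
    and D: "D = a + u\<^sup>2 * cnj (A - a)" and C: "C = a + u\<^sup>2 * cnj (B - a)"
    using assms unfolding darboux_butterfly_def isosceles_trapezoid_def line_reflection_def by metis
  have uu: "u\<^sup>2 * cnj (u\<^sup>2) = 1"
    using complex_norm_square[of "u\<^sup>2"] u by (simp add: norm_power)
  have sides: "D - C = - (u\<^sup>2 * cnj (B - A))"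
    by (simp add: C D algebra_simps)
  have "u\<^sup>2 * cnj (C - a) = (u\<^sup>2 * cnj (u\<^sup>2)) * (B - a)"
    by (simp add: C)
  also have "\<dots> = B - a"
    by (simp only: uu mult_1_left)
  finally have "u\<^sup>2 * cnj (C - a) = B - a" .
  then have diagonals: "D - B = - (u\<^sup>2 * cnj (C - A))"
    by (simp add: D algebra_simps)
  show ?thesis
    unfolding complex_norm_square sides diagonals by (simp add: mult_ac)
qed

lemma parallelogram_law_equal_diagonals:
  fixes x y :: complex
  assumes "norm (y - x) = \<rho>" "norm (x + y) = \<rho>"
  shows "(norm x)\<^sup>2 + (norm y)\<^sup>2 = \<rho>\<^sup>2"
proof -
  have "(norm (y - x))\<^sup>2 + (norm (x + y))\<^sup>2 = 2 * ((norm x)\<^sup>2 + (norm y)\<^sup>2)"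
    unfolding cmod_power2 by (simp add: power2_eq_square algebra_simps)
  then show ?thesis
    using assms by simp
qed

section \<open>Periodic families\<close>

lemma polygon_periodic:
  assumes "polygon n V"
  shows "V (i + int n * j) = V i"
proof (induction j rule: int_induct[where k = 0])
  case (step1 j)
  then show ?case
    using assms[unfolded polygon_def, THEN conjunct1, rule_format, of "i + int n * j"]
    by (simp add: algebra_simps)
next
  case (step2 j)
  then show ?case
    using assms[unfolded polygon_def, THEN conjunct1, rule_format, of "i + int n * (j - 1)"]
    by (simp add: algebra_simps)
qed simp

lemma polygon_eq_iff:
  assumes "polygon n V" "n > 0"
  shows "V i = V j \<longleftrightarrow> int n dvd i - j"
proof -
  have red: "V l = V (l mod int n)" for l
    using polygon_periodic[OF assms(1), of "l mod int n" "l div int n"] by simp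
  have inj: "inj_on V {0..<int n}"
    using assms(1) by (simp add: polygon_def)
  have "V i = V j \<longleftrightarrow> V (i mod int n) = V (j mod int n)"
    using red[of i] red[of j] by simp
  also have "\<dots> \<longleftrightarrow> i mod int n = j mod int n"
    using inj_on_eq_iff[OF inj] \<open>n > 0\<close> by simp
  also have "\<dots> \<longleftrightarrow> int n dvd i - j"
    by (rule mod_eq_dvd_iff)
  finally show ?thesis .
qed

lemma polygon_distinct:
  assumes "polygon n V" "0 < d" "d < int n"
  shows "V (i + d) \<noteq> V i"
  using polygon_eq_iff[OF assms(1), of "i + d" i] assms(2,3) zdvd_imp_le[of "int n" d] by auto

lemma int_step_invariant_const:
  fixes f :: "int \<Rightarrow> 'a"
  assumes "\<And>i. f (i + 1) = f i"
  shows "f i = f 0"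
proof (induction i rule: int_induct[where k = 0])
  case (step2 i)
  then show ?case
    using assms[of "i - 1"] by simp
qed (simp_all add: assms)

section \<open>Bicycle (4k,k)-gons\<close>

text \<open>
  Here \<open>a, b, - a, - b\<close> are the sides of a rhombus, \<open>a', b', - a', - b'\<close> those of the next one, and
  \<open>s0, s1, s2, s3\<close> the steps made by its vertices. The product relations give \<open>s1\<^sup>2 = s3\<^sup>2\<close>. If
  \<open>s1 = s3\<close>, all four steps agree, the rhombus is translated, and the products say that \<open>a\<^sup>2\<close> and \<open>b\<^sup>2\<close>
  both are \<open>(R * s0 / l)\<^sup>2\<close>, so the rhombus is flat. Hence \<open>s1 = - s3\<close>, and then \<open>s2 = - s0\<close>.
\<close>

lemma rhombus_center_step:
  fixes s0 s1 s2 s3 a b a' b' :: complex and l R :: real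
  assumes "l \<noteq> 0" "R \<noteq> 0" and nz: "s0 \<noteq> 0" "s1 \<noteq> 0" "s2 \<noteq> 0" "s3 \<noteq> 0"
    and prods: "s0 * s1 * of_real (R\<^sup>2) = a * a' * of_real (l\<^sup>2)"
      "s1 * s2 * of_real (R\<^sup>2) = b * b' * of_real (l\<^sup>2)"
      "s2 * s3 * of_real (R\<^sup>2) = a * a' * of_real (l\<^sup>2)"
      "s3 * s0 * of_real (R\<^sup>2) = b * b' * of_real (l\<^sup>2)"
    and diffs: "s0 - s1 = a - a'" "s1 - s2 = b - b'" "s2 - s3 = a' - a"
    and flat: "a \<noteq> b" "a \<noteq> - b"
  shows "s2 = - s0"
proof -
  have 1: "s0 * s1 = s2 * s3" and 2: "s1 * s2 = s3 * s0"
    using prods \<open>R \<noteq> 0\<close> by (metis mult_right_cancel of_real_eq_0_iff power_not_zero)+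
  have "(s0 * s1) * (s1 * s2) = (s2 * s3) * (s3 * s0)"
    using 1 2 by simp
  then have "s1\<^sup>2 = s3\<^sup>2"
    using nz by (simp add: power2_eq_square mult_ac)
  then have "s1 = s3 \<or> s1 = - s3"
    by (simp add: power2_eq_iff)
  then show ?thesis
  proof
    assume "s1 = s3"
    then have "s0 = s2"
      using 1 nz by (simp add: mult.commute)
    have "s0 - s1 = - (s0 - s1)"
      using diffs(1,3) \<open>s0 = s2\<close> \<open>s1 = s3\<close> by (metis minus_diff_eq)
    then have "s0 = s1"
      by (simp add: complex_eq_iff)
    then have "a' = a" "b' = b"
      using diffs \<open>s0 = s2\<close> by auto
    then have "a * a * of_real (l\<^sup>2) = b * b * of_real (l\<^sup>2)"
      using prods \<open>s0 = s1\<close> \<open>s0 = s2\<close> \<open>s1 = s3\<close> by metis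
    then have "a\<^sup>2 = b\<^sup>2"
      using \<open>l \<noteq> 0\<close> by (simp add: power2_eq_square)
    then show ?thesis
      using flat by (simp add: power2_eq_iff)
  next
    assume "s1 = - s3"
    then show ?thesis
      using 1 nz by (metis minus_minus mult.commute mult_cancel_left mult_minus_left)
  qed
qed

lemma bicycle_polygon_side_diagonal_relations:
  assumes "k \<ge> 1" "bicycle_polygon (4 * k) k V"
  obtains l R :: real where "l \<noteq> 0" "R \<noteq> 0"
    and "\<And>i. norm (V (i + 1) - V i) = l"
    and "\<And>i. norm (V (i + int k) - V i) = R"
    and "\<And>i. (V (i + 1) - V i) * (V (i + int k + 1) - V (i + int k)) * of_real (R\<^sup>2)
      = (V (i + int k) - V i) * (V (i + int k + 1) - V (i + 1)) * of_real (l\<^sup>2)"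
proof -
  define l where "l = dist (V 0) (V 1)"
  define R where "R = dist (V 0) (V (int k))"
  have poly: "polygon (4 * k) V"
    using assms(2) by (simp add: bicycle_polygon_def)
  have side: "norm (V (i + 1) - V i) = l" for i
    using assms(2) unfolding bicycle_polygon_def l_def dist_norm
    by (metis add_0 norm_minus_commute)
  have diag: "norm (V (i + int k) - V i) = R" for i
    using assms(2) unfolding bicycle_polygon_def R_def dist_norm
    by (metis add_0 norm_minus_commute)
  show thesis
  proof (rule that)
    show "l \<noteq> 0"
      using polygon_distinct[OF poly, of 1 0] assms(1) by (auto simp: l_def)
    show "R \<noteq> 0"
      using polygon_distinct[OF poly, of "int k" 0] assms(1) by (auto simp: R_def)
    show "(V (i + 1) - V i) * (V (i + int k + 1) - V (i + int k)) * of_real (R\<^sup>2)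
      = (V (i + int k) - V i) * (V (i + int k + 1) - V (i + 1)) * of_real (l\<^sup>2)" for i
      using assms(2)
        darboux_butterfly_products[of "V i" "V (i + 1)" "V (i + int k + 1)" "V (i + int k)"]
      unfolding bicycle_polygon_def side diag by blast
  qed (fact side diag)+
qed

text \<open>
  By \<open>rhombus_center_step\<close>, the sum of opposite vertices of the rhombus does not depend on time.
\<close>

lemma bicycle_polygon_central_symmetry:
  assumes "k \<ge> 1" "bicycle_polygon (4 * k) k V"
  obtains c where "\<And>i. V (i + 2 * int k) - c = - (V i - c)"
proof -
  define K where "K = int k"
  have K: "K \<ge> 1" using assms(1) by (simp add: K_def)
  obtain l R :: real where l0: "l \<noteq> 0" and R0: "R \<noteq> 0"
    and side: "\<And>i. norm (V (i + 1) - V i) = l"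
    and diag: "\<And>i. norm (V (i + K) - V i) = R"
    and butterfly: "\<And>i. (V (i + 1) - V i) * (V (i + K + 1) - V (i + K)) * of_real (R\<^sup>2)
      = (V (i + K) - V i) * (V (i + K + 1) - V (i + 1)) * of_real (l\<^sup>2)"
    using bicycle_polygon_side_diagonal_relations[OF assms, folded K_def] by blast
  have poly: "polygon (4 * k) V"
    using assms(2) by (simp add: bicycle_polygon_def)
  have per: "V (i + 4 * K) = V i" for i
    using poly by (simp add: polygon_def K_def)
  have distinct: "V (i + d) \<noteq> V i" if "0 < d" "d < 4 * K" for i d
    using polygon_distinct[OF poly] that by (simp add: K_def)
  have rhombus: "V i + V (i + 2 * K) = V (i + K) + V (i + 3 * K)" for i
  proof (rule rhombus_is_parallelogram)
    show "norm (V (i + K) - V i) = R"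
      by (rule diag)
    show "norm (V (i + 2 * K) - V (i + K)) = R"
      using diag[of "i + K"] by (simp add: algebra_simps)
    show "norm (V (i + 3 * K) - V (i + 2 * K)) = R"
      using diag[of "i + 2 * K"] by (simp add: algebra_simps)
    show "norm (V i - V (i + 3 * K)) = R"
      using diag[of "i + 3 * K"] per[of i] by (simp add: algebra_simps)
    show "V i \<noteq> V (i + 2 * K)"
      using distinct[of "2 * K" i] K by simp
    show "V (i + K) \<noteq> V (i + 3 * K)"
      using distinct[of "2 * K" "i + K"] K by (simp add: algebra_simps)
  qed
  have center: "V (i + 1) + V (i + 1 + 2 * K) = V i + V (i + 2 * K)" for i
  proof -
    define s where "s j = V (i + j * K + 1) - V (i + j * K)" for j
    define a where "a = V (i + K) - V i"
    define b where "b = V (i + 2 * K) - V (i + K)"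
    define a' where "a' = V (i + K + 1) - V (i + 1)"
    define b' where "b' = V (i + 2 * K + 1) - V (i + K + 1)"
    have r: "V (i + 3 * K) - V (i + 2 * K) = - a" "V i - V (i + 3 * K) = - b"
      using rhombus[of i] by (simp_all add: a_def b_def algebra_simps)
    have r': "V (i + 3 * K + 1) - V (i + 2 * K + 1) = - a'" "V (i + 1) - V (i + 3 * K + 1) = - b'"
      using rhombus[of "i + 1"] by (simp_all add: a'_def b'_def algebra_simps)
    \<comment> \<open>The last two products come from the sides \<open>- a\<close> and \<open>- b\<close>, whose signs cancel.\<close>
    have "s 2 = - s 0"
    proof (rule rhombus_center_step[OF l0 R0])
      have "s j \<noteq> 0" for j
        using distinct[of 1 "i + j * K"] K by (simp add: s_def)
      then show "s 0 \<noteq> 0" "s 1 \<noteq> 0" "s 2 \<noteq> 0" "s 3 \<noteq> 0" by blast+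
      show "s 0 * s 1 * of_real (R\<^sup>2) = a * a' * of_real (l\<^sup>2)"
        using butterfly[of i] by (simp add: s_def a_def a'_def)
      have e: "i + K + K = i + 2 * K" "i + 2 * K + K = i + 3 * K" "i + 3 * K + K = i + 4 * K"
        "i + 4 * K + 1 = i + 1 + 4 * K"
        by simp_all
      show "s 1 * s 2 * of_real (R\<^sup>2) = b * b' * of_real (l\<^sup>2)"
        using butterfly[of "i + K"] unfolding e by (simp add: s_def b_def b'_def)
      have "s 2 * s 3 * of_real (R\<^sup>2) = (- a) * (- a') * of_real (l\<^sup>2)"
        using butterfly[of "i + 2 * K"] unfolding e r[symmetric] r'[symmetric] by (simp add: s_def)
      then show "s 2 * s 3 * of_real (R\<^sup>2) = a * a' * of_real (l\<^sup>2)"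
        by simp
      have "s 3 * s 0 * of_real (R\<^sup>2) = (- b) * (- b') * of_real (l\<^sup>2)"
        using butterfly[of "i + 3 * K"]
        unfolding e per r[symmetric] r'[symmetric] by (simp add: s_def)
      then show "s 3 * s 0 * of_real (R\<^sup>2) = b * b' * of_real (l\<^sup>2)"
        by simp
      show "s 0 - s 1 = a - a'" "s 1 - s 2 = b - b'"
        by (simp_all add: s_def a_def a'_def b_def b'_def)
      have "s 3 - s 2 = - a' - - a"
        unfolding r[symmetric] r'[symmetric] by (simp add: s_def)
      then show "s 2 - s 3 = a' - a"
        by (simp add: algebra_simps)
      show "a \<noteq> b"
      proof
        assume "a = b"
        then have "V (i + 3 * K) - V (i + 2 * K) = V (i + K) - V (i + 2 * K)"
          using r(1) by (simp add: b_def)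
        then show False
          using distinct[of "2 * K" "i + K"] K by (simp add: algebra_simps)
      qed
      show "a \<noteq> - b"
        using distinct[of "2 * K" i] K by (auto simp: a_def b_def algebra_simps)
    qed
    then show ?thesis
      by (simp add: s_def algebra_simps)
  qed
  define c where "c = (V 0 + V (2 * K)) / 2"
  have "V i + V (i + 2 * K) = V 0 + V (0 + 2 * K)" for i
    using int_step_invariant_const[of "\<lambda>i. V i + V (i + 2 * K)" i] center by simp
  then have "V i + V (i + 2 * K) = 2 * c" for i
    by (simp add: c_def)
  then have "V (i + 2 * int k) - c = - (V i - c)" for i
    unfolding K_def by (simp add: algebra_simps)
  then show thesis
    by (rule that)
qed


text \<open>
  The radii and the turning angles of the polygon around its center of symmetry. The radii alternate
  because the butterflies on two adjacent sides of the rhombus force \<open>W (i + 1)\<close> and \<open>W (i + k)\<close>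
  to have the same norm. The last equation says that the angle from
  \<open>W i\<close> to \<open>W (i + 1)\<close> is the one from \<open>W (i + 1)\<close> to \<open>W (i + 2)\<close>; it could only fail if the polygon
  turned back to \<open>V (i + 2) = V i\<close>, but its vertices are distinct.
\<close>

lemma bicycle_polygon_centered_relations:
  assumes "k \<ge> 1" "bicycle_polygon (4 * k) k V"
    and sym: "\<And>i. V (i + 2 * int k) - c = - (V i - c)"
  defines "W \<equiv> \<lambda>i. V i - c"
  shows "W i \<noteq> 0"
    and "norm (W (i + 2)) = norm (W i)"
    and "even k \<Longrightarrow> norm (W (i + 1)) = norm (W i)"
    and "W (i + 2) * cnj (W (i + 1)) = W (i + 1) * cnj (W i)"
proof -
  define K where "K = int k"
  have K: "K \<ge> 1" using assms(1) by (simp add: K_def)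
  obtain l R :: real where l0: "l \<noteq> 0" and R0: "R \<noteq> 0"
    and side: "\<And>i. norm (V (i + 1) - V i) = l"
    and diag: "\<And>i. norm (V (i + K) - V i) = R"
    and butterfly: "\<And>i. (V (i + 1) - V i) * (V (i + K + 1) - V (i + K)) * of_real (R\<^sup>2)
      = (V (i + K) - V i) * (V (i + K + 1) - V (i + 1)) * of_real (l\<^sup>2)"
    using bicycle_polygon_side_diagonal_relations[OF assms(1,2), folded K_def] by blast
  have poly: "polygon (4 * k) V"
    using assms(2) by (simp add: bicycle_polygon_def)
  have distinct: "V (i + d) \<noteq> V i" if "0 < d" "d < 4 * K" for i d
    using polygon_distinct[OF poly] that by (simp add: K_def)
  have opposite: "W (i + 2 * K) = - W i" for i
    using sym by (simp add: W_def K_def)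
  show nz: "W i \<noteq> 0" for i
    using distinct[of "2 * K" i] opposite[of i] K by (auto simp: W_def)
  have diffs: "V i - V j = W i - W j" for i j
    by (simp add: W_def)
  have pythagoras: "(norm (W i))\<^sup>2 + (norm (W (i + K)))\<^sup>2 = R\<^sup>2" for i
  proof (rule parallelogram_law_equal_diagonals)
    show "norm (W (i + K) - W i) = R"
      using diag[of i] by (simp add: diffs)
    have "norm (W (i + 2 * K) - W (i + K)) = R"
      using diag[of "i + K"] by (simp add: diffs add.assoc)
    then show "norm (W i + W (i + K)) = R"
      unfolding opposite by (metis minus_add_distrib norm_minus_cancel uminus_add_conv_diff add.commute)
  qed
  \<comment> \<open>The sides of the butterflies at \<open>i\<close> and \<open>i + k\<close> have opposite products, hence so do the diagonals.\<close>
  have products: "W (i + K) * W (i + K + 1) = - (W i * W (i + 1))" for i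
  proof -
    define x y z w where "x = W i" and "y = W (i + K)" and "z = W (i + 1)" and "w = W (i + K + 1)"
    have e: "i + K + K = i + 2 * K" "i + 2 * K + 1 = i + 1 + 2 * K"
      by simp_all
    have 1: "(z - x) * (w - y) * of_real (R\<^sup>2) = (y - x) * (w - z) * of_real (l\<^sup>2)"
      using butterfly[of i] by (simp add: diffs x_def y_def z_def w_def)
    have 2: "(w - y) * (- z - - x) * of_real (R\<^sup>2) = (- x - y) * (- z - w) * of_real (l\<^sup>2)"
      using butterfly[of "i + K"] unfolding e diffs opposite by (simp only: x_def y_def z_def w_def)
    have "(y - x) * (w - z) * of_real (l\<^sup>2) + (- x - y) * (- z - w) * of_real (l\<^sup>2)
        = (z - x) * (w - y) * of_real (R\<^sup>2) + (w - y) * (- z - - x) * of_real (R\<^sup>2)"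
      by (simp only: 1 2)
    also have "\<dots> = 0"
      by (simp add: algebra_simps)
    finally have "(y - x) * (w - z) * of_real (l\<^sup>2) + (- x - y) * (- z - w) * of_real (l\<^sup>2) = 0" .
    then have "(2 * (y * w + x * z)) * of_real (l\<^sup>2) = 0"
      by (simp add: algebra_simps)
    then have "y * w + x * z = 0"
      using l0 by (metis mult_eq_0_iff of_real_eq_0_iff power_not_zero zero_neq_numeral)
    then show ?thesis
      by (simp add: x_def y_def z_def w_def eq_neg_iff_add_eq_0)
  qed
  \<comment> \<open>If \<open>\<alpha> + \<alpha>' = R\<^sup>2 = \<beta> + \<beta>'\<close> and \<open>\<alpha>' * \<beta>' = \<alpha> * \<beta>\<close>, then \<open>\<alpha> + \<beta> = R\<^sup>2\<close>.\<close>
  have adjacent: "(norm (W i))\<^sup>2 + (norm (W (i + 1)))\<^sup>2 = R\<^sup>2" for i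
  proof -
    have "norm (W (i + K)) * norm (W (i + K + 1)) = norm (W i) * norm (W (i + 1))"
      using arg_cong[OF products, of norm] by (simp add: norm_mult)
    then have prod: "(norm (W (i + K)))\<^sup>2 * (norm (W (i + K + 1)))\<^sup>2 = (norm (W i))\<^sup>2 * (norm (W (i + 1)))\<^sup>2"
      by (metis power_mult_distrib)
    have norms: "(norm (W (i + K)))\<^sup>2 = R\<^sup>2 - (norm (W i))\<^sup>2"
      "(norm (W (i + K + 1)))\<^sup>2 = R\<^sup>2 - (norm (W (i + 1)))\<^sup>2"
      using pythagoras[of i] pythagoras[of "i + 1"] by (simp_all add: algebra_simps)
    have "R\<^sup>2 * (R\<^sup>2 - ((norm (W i))\<^sup>2 + (norm (W (i + 1)))\<^sup>2)) = 0"
      using prod unfolding norms by (simp add: algebra_simps)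
    then show ?thesis
      using R0 by simp
  qed
  show second: "norm (W (i + 2)) = norm (W i)" for i
  proof -
    have "(norm (W (i + 2)))\<^sup>2 = (norm (W i))\<^sup>2"
      using adjacent[of i] adjacent[of "i + 1"] unfolding add.assoc one_add_one by linarith
    then show ?thesis
      by simp
  qed
  show "norm (W (i + 1)) = norm (W i)" if "even k"
  proof -
    have shift: "norm (W (i + 2 * int n)) = norm (W i)" for n
    proof (induction n)
      case (Suc n)
      then show ?case
        using second[of "i + 2 * int n"] by (simp add: algebra_simps)
    qed simp
    have "K = 2 * int (k div 2)"
      using that unfolding K_def by (elim evenE) simp
    then have same: "norm (W (i + K)) = norm (W i)"
      using shift by metis
    have "(norm (W (i + 1)))\<^sup>2 = (norm (W i))\<^sup>2"
      using adjacent[of i] pythagoras[of i] unfolding same by linarith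
    then show ?thesis
      by simp
  qed
  show "W (i + 2) * cnj (W (i + 1)) = W (i + 1) * cnj (W i)"
  proof (rule mirror_image_if_equidistant)
    show "norm (W i) = norm (W (i + 2))"
      by (simp add: second)
    show "norm (W i - W (i + 1)) = norm (W (i + 2) - W (i + 1))"
      using side[of i] side[of "i + 1"] by (simp add: diffs norm_minus_commute add.assoc)
    show "W i \<noteq> W (i + 2)"
      using distinct[of 2 i] K by (simp add: W_def)
  qed
qed

lemma cis_eq_1_iff:
  "cis t = 1 \<longleftrightarrow> (\<exists>n::int. t = 2 * pi * of_int n)"
proof
  assume "cis t = 1"
  then have "cos t = 1"
    by (metis cis.sel(1) one_complex.sel(1))
  then show "\<exists>n::int. t = 2 * pi * of_int n"
    by (auto simp: cos_one_2pi_int mult_ac)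
qed auto

text \<open>
  By the hypothesis, the unit complex number \<open>sgn (W (i + 1) * cnj (W i))\<close>, which rotates the direction
  of \<open>W i\<close> into that of \<open>W (i + 1)\<close>, is the same for all \<open>i\<close>.
\<close>

lemma constant_turning_polar_form:
  fixes W :: "int \<Rightarrow> complex"
  assumes nz: "\<And>i. W i \<noteq> 0"
    and turn: "\<And>i. W (i + 2) * cnj (W (i + 1)) = W (i + 1) * cnj (W i)"
  obtains \<theta> \<delta> where "\<And>i. W i = of_real (norm (W i)) * cis (\<theta> + of_int i * \<delta>)"
proof -
  define e where "e i = sgn (W (i + 1) * cnj (W i))" for i
  define \<delta> where "\<delta> = Arg (e 0)"
  define \<theta> where "\<theta> = Arg (W 0)"
  have "e i = e 0" for i
    using int_step_invariant_const[of e i] turn by (simp add: e_def add.assoc)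
  moreover have "e 0 = cis \<delta>"
    unfolding \<delta>_def using nz by (subst cis_Arg) (simp_all add: e_def sgn_zero_iff)
  ultimately have e: "e i = cis \<delta>" for i
    by simp
  have unit: "cnj (sgn (W i)) * sgn (W i) = 1" for i
    using complex_norm_square[of "sgn (W i)"] nz by (simp add: norm_sgn mult.commute)
  have step: "sgn (W (i + 1)) = cis \<delta> * sgn (W i)" for i
  proof -
    have "cis \<delta> * sgn (W i) = sgn (W (i + 1)) * (cnj (sgn (W i)) * sgn (W i))"
      unfolding e[of i, symmetric] by (simp add: e_def sgn_eq norm_mult mult_ac)
    then show ?thesis
      by (simp only: unit mult_1_right)
  qed
  define f where "f i = sgn (W i) / cis (of_int i * \<delta>)" for i
  have "f (i + 1) = f i" for i
  proof -
    have "cis (of_int (i + 1) * \<delta>) = cis \<delta> * cis (of_int i * \<delta>)"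
      by (simp add: cis_mult algebra_simps)
    then show ?thesis
      by (simp add: f_def step)
  qed
  then have "f i = cis \<theta>" for i
    using int_step_invariant_const[of f i] nz by (simp add: f_def \<theta>_def cis_Arg)
  then have direction: "sgn (W i) = cis (\<theta> + of_int i * \<delta>)" for i
    unfolding cis_mult[symmetric] f_def by (metis cis_neq_zero nonzero_divide_eq_eq)
  have "W i = of_real (norm (W i)) * sgn (W i)" for i
    using nz[of i] by (simp add: sgn_eq)
  then have "W i = of_real (norm (W i)) * cis (\<theta> + of_int i * \<delta>)" for i
    unfolding direction .
  then show thesis
    by (rule that)
qed

lemma bicycle_polygon_polar_form:
  assumes "k \<ge> 1" "bicycle_polygon (4 * k) k V"
  obtains c p q \<theta> m where "p > 0" "q > 0" "even k \<longrightarrow> p = q"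
    and "\<forall>i. V i = c + of_real (if even i then p else q)
               * cis (\<theta> + 2 * pi * of_int m * of_int i / of_nat (4 * k))"
proof -
  obtain c where c: "\<And>i. V (i + 2 * int k) - c = - (V i - c)"
    using bicycle_polygon_central_symmetry[OF assms] by blast
  define W where "W i = V i - c" for i
  note rel = bicycle_polygon_centered_relations[OF assms c, folded W_def]
  obtain \<theta> \<delta> where polar: "\<And>i. W i = of_real (norm (W i)) * cis (\<theta> + of_int i * \<delta>)"
    using constant_turning_polar_form[of W] rel(1,4) by blast
  have "W (0 + int (4 * k)) = W 0"
    using assms(2) unfolding bicycle_polygon_def polygon_def W_def by metis
  then have "of_real (norm (W 0)) * cis (\<theta> + of_int (int (4 * k)) * \<delta>)
      = of_real (norm (W 0)) * cis \<theta>"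
    using polar[of "int (4 * k)"] polar[of 0] by simp
  then have "cis \<theta> * cis (real (4 * k) * \<delta>) = cis \<theta> * 1"
    using rel(1)[of 0] by (simp add: cis_mult)
  then have "cis (real (4 * k) * \<delta>) = 1"
    by (metis cis_neq_zero mult_left_cancel)
  then obtain m :: int where m: "real (4 * k) * \<delta> = 2 * pi * of_int m"
    unfolding cis_eq_1_iff by blast
  have \<delta>: "\<delta> = 2 * pi * of_int m / of_nat (4 * k)"
    using m assms(1) by (simp add: field_simps)
  have even: "norm (W (2 * j)) = norm (W 0)" for j
    using int_step_invariant_const[of "\<lambda>j. norm (W (2 * j))" j] rel(2) by (simp add: distrib_left)
  have odd: "norm (W (2 * j + 1)) = norm (W 1)" for j
  proof -
    have "norm (W (2 * (j + 1) + 1)) = norm (W (2 * j + 1))" for j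
      using rel(2)[of "2 * j + 1"] by (simp add: algebra_simps)
    from int_step_invariant_const[of "\<lambda>j. norm (W (2 * j + 1))", OF this, of j]
    show ?thesis by simp
  qed
  have norms: "norm (W i) = (if even i then norm (W 0) else norm (W 1))" for i
    by (cases "even i") (auto simp: even odd elim!: evenE oddE)
  show thesis
  proof (rule that)
    show "norm (W 0) > 0" "norm (W 1) > 0"
      using rel(1) by simp_all
    show "even k \<longrightarrow> norm (W 0) = norm (W 1)"
      using rel(3)[of 0] by simp
    show "\<forall>i. V i = c + of_real (if even i then norm (W 0) else norm (W 1))
               * cis (\<theta> + 2 * pi * of_int m * of_int i / of_nat (4 * k))"
    proof
      fix i
      show "V i = c + of_real (if even i then norm (W 0) else norm (W 1))
               * cis (\<theta> + 2 * pi * of_int m * of_int i / of_nat (4 * k))"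
        using polar[of i] unfolding norms[of i, symmetric] \<delta> by (simp add: W_def mult_ac)
    qed
  qed
qed

section \<open>Points spaced on a circle\<close>

text \<open>
  With a common factor \<open>g\<close> of \<open>m\<close> and \<open>N\<close>, the points would recur already after \<open>N / g\<close> steps.
\<close>

lemma coprime_if_points_distinct:
  fixes N :: nat and m :: int
  assumes "N > 0"
    and distinct: "\<And>j. 0 < j \<Longrightarrow> j < int N \<Longrightarrow>
      c + of_real r * cis (\<theta> + 2 * pi * of_int m * of_int j / of_nat N) \<noteq> c + of_real r * cis \<theta>"
  shows "coprime m (int N)"
proof (rule ccontr)
  assume "\<not> coprime m (int N)"
  define g where "g = gcd m (int N)"
  have "g > 0"
    using assms(1) by (simp add: g_def)
  moreover have "g \<noteq> 1"
    using \<open>\<not> coprime m (int N)\<close> by (simp add: g_def coprime_iff_gcd_eq_1)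
  ultimately have g: "g > 1"
    by simp
  obtain m' where m': "m = g * m'"
    using gcd_dvd1[of m "int N"] unfolding g_def dvd_def by auto
  obtain j where j: "int N = g * j"
    using gcd_dvd2[of m "int N"] unfolding g_def dvd_def by auto
  have "j > 0"
    using j g assms(1) by (metis of_nat_0_less_iff zero_less_mult_pos less_trans zero_less_one)
  then have "j < int N"
    using g j by simp
  have N: "real N = of_int g * of_int j"
    using j by (metis of_int_mult of_int_of_nat_eq)
  have "2 * pi * of_int m * of_int j / of_nat N = 2 * pi * of_int m'"
    unfolding N m' using g \<open>j > 0\<close> by simp
  then have "cis (\<theta> + 2 * pi * of_int m * of_int j / of_nat N) = cis \<theta>"
    by (simp add: cis_mult[symmetric])
  then show False
    using distinct[OF \<open>j > 0\<close> \<open>j < int N\<close>] by simp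
qed

text \<open>
  Multiplication by \<open>m\<close> permutes the residues modulo \<open>N\<close>, so a star polygon has the same vertex set as
  the convex one.
\<close>

lemma equally_spaced_if_coprime_steps:
  fixes N :: nat and m :: int
  assumes "N > 0" "r > 0" "coprime m (int N)"
  shows "equally_spaced_on_circle N c r
    (range (\<lambda>j::int. c + of_real r * cis (\<theta> + 2 * pi * of_int m * of_int j / of_nat N)))"
proof -
  define P where "P n = c + of_real r * cis (\<theta> + 2 * pi * of_int n / of_nat N)" for n :: int
  have P_cong: "P a = P b" if "a mod int N = b mod int N" for a b
  proof -
    obtain d where "a - b = int N * d"
      using \<open>a mod int N = b mod int N\<close> by (metis mod_eq_dvd_iff dvd_def)
    then have "a = b + int N * d"
      by simp
    then have "\<theta> + 2 * pi * of_int a / of_nat N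
        = (\<theta> + 2 * pi * of_int b / of_nat N) + 2 * pi * of_int d"
      using assms(1) by (simp add: field_simps)
    then show ?thesis
      unfolding P_def by (simp only: cis_mult[symmetric]) simp
  qed
  have "range (\<lambda>j. P (m * j)) = (\<lambda>j. P (int j)) ` {..<N}"
  proof (intro equalityI subsetI)
    fix z assume "z \<in> range (\<lambda>j. P (m * j))"
    then obtain j where z: "z = P (m * j)"
      by blast
    define n where "n = nat ((m * j) mod int N)"
    have "n < N" "int n = (m * j) mod int N"
      using assms(1) by (simp_all add: n_def nat_less_iff)
    then show "z \<in> (\<lambda>j. P (int j)) ` {..<N}"
      using P_cong[of "m * j" "int n"] z by (metis imageI lessThan_iff mod_mod_trivial)
  next
    fix z assume "z \<in> (\<lambda>j. P (int j)) ` {..<N}"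
    then obtain n where z: "z = P (int n)"
      by blast
    obtain a b where "a * m + b * int N = 1"
      using bezout_int[of m "int N"] assms(3) by (auto simp: coprime_iff_gcd_eq_1)
    then have "int n = m * (a * int n) + (b * int n) * int N"
      by (metis distrib_right mult.commute mult.left_commute mult_1)
    then have "P (int n) = P (m * (a * int n))"
      using P_cong by (metis mod_mult_self1)
    then show "z \<in> range (\<lambda>j. P (m * j))"
      using z by blast
  qed
  then show ?thesis
    unfolding equally_spaced_on_circle_def P_def using assms(2)
    by (intro conjI exI[of _ \<theta>]) (simp_all add: mult.assoc)
qed

text \<open>
  The middle direction \<open>w\<close> bisects the angle at \<open>c\<close>: the midpoint of \<open>A\<close> and \<open>B\<close> lies at \<open>p * cos \<delta>\<close> on
  it, and \<open>M\<close> at \<open>q\<close>. The left normal of the side is \<open>- w\<close> or \<open>w\<close>, depending on the direction in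
  which the side turns around \<open>c\<close>; this explains the factor \<open>sgn (sin \<delta>)\<close>.
\<close>

lemma insertion_between_rotated_points:
  fixes c :: complex and \<phi> \<delta> p q :: real
  assumes "p > 0" "sin \<delta> \<noteq> 0"
  defines "A \<equiv> c + of_real p * cis \<phi>"
    and "M \<equiv> c + of_real q * cis (\<phi> + \<delta>)"
    and "B \<equiv> c + of_real p * cis (\<phi> + 2 * \<delta>)"
  shows "M = midpoint A B + of_real ((p * cos \<delta> - q) * sgn (sin \<delta>)) * (\<i> * sgn (B - A))"
proof -
  define w where "w = cis (\<phi> + \<delta>)"
  have A: "A = c + of_real p * (w * cis (- \<delta>))" and B: "B = c + of_real p * (w * cis \<delta>)"
    by (simp_all add: A_def B_def w_def cis_mult algebra_simps)
  have mid: "midpoint A B = c + of_real (p * cos \<delta>) * w"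
    unfolding midpoint_def A B by (simp add: complex_eq_iff scaleR_conv_of_real field_simps)
  have "cis \<delta> - cis (- \<delta>) = 2 * \<i> * of_real (sin \<delta>)"
    by (simp add: complex_eq_iff)
  then have diff: "B - A = of_real p * w * (2 * \<i> * of_real (sin \<delta>))"
    unfolding A B by (simp add: algebra_simps)
  have "sgn w = w" "sgn (2 :: complex) = 1" "sgn \<i> = \<i>"
    by (simp_all add: w_def sgn_eq)
  then have "sgn (B - A) = w * \<i> * of_real (sgn (sin \<delta>))"
    unfolding diff using assms(1) by (simp add: sgn_mult sgn_of_real)
  then have "of_real ((p * cos \<delta> - q) * sgn (sin \<delta>)) * (\<i> * sgn (B - A))
      = of_real (q - p * cos \<delta>) * w * of_real (sgn (sin \<delta>) * sgn (sin \<delta>))"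
    unfolding of_real_mult by (simp add: algebra_simps del: sgn_mult_self_eq)
  also have "sgn (sin \<delta>) * sgn (sin \<delta>) = 1"
    using assms(2) by (simp add: sgn_if)
  finally show ?thesis
    by (simp add: mid M_def w_def algebra_simps)
qed

theorem theorem9:
  fixes k :: nat and V :: "int \<Rightarrow> complex"
  assumes "k \<ge> 1"
    and "bicycle_polygon (4 * k) k V"
  shows "(even k \<longrightarrow> regular_polygon (4 * k) V) \<and>
         (odd k \<longrightarrow>
            (\<exists>c r\<^sub>e r\<^sub>o.
               equally_spaced_on_circle (2 * k) c r\<^sub>e (V ` {i. even i}) \<and>
               equally_spaced_on_circle (2 * k) c r\<^sub>o (V ` {i. odd i})) \<and>
            (\<exists>U h. regular_polygon (2 * k) U \<and> obtained_by_insertion U h V))"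
proof -
  have poly: "polygon (4 * k) V"
    using assms(2) by (simp add: bicycle_polygon_def)
  obtain c p q \<theta> m where p: "p > 0" and q: "q > 0" and pq: "even k \<longrightarrow> p = q"
    and V_all: "\<forall>i. V i = c + of_real (if even i then p else q)
               * cis (\<theta> + 2 * pi * of_int m * of_int i / of_nat (4 * k))"
    by (rule bicycle_polygon_polar_form[OF assms])
  note V = V_all[rule_format]
  have distinct: "V i \<noteq> V 0" if "0 < i" "i < int (4 * k)" for i
    using polygon_distinct[OF poly that, of 0] by simp
  have regular: "regular_polygon (4 * k) V" if "even k"
  proof -
    have V': "V i = c + of_real p * cis (\<theta> + 2 * pi * of_int m * of_int i / of_nat (4 * k))" for i
      using V[of i] pq that by simp
    have "coprime m (int (4 * k))"
    proof (rule coprime_if_points_distinct)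
      show "c + of_real p * cis (\<theta> + 2 * pi * of_int m * of_int j / of_nat (4 * k))
          \<noteq> c + of_real p * cis \<theta>" if "0 < j" "j < int (4 * k)" for j
        using distinct[OF that] unfolding V' by simp
    qed (use assms(1) in simp)
    then show ?thesis
      unfolding regular_polygon_def using p V' by blast
  qed
  define U where "U j = V (2 * j)" for j
  define \<delta> where "\<delta> = 2 * pi * of_int m / of_nat (4 * k)"
  have U: "U j = c + of_real p * cis (\<theta> + 2 * pi * of_int m * of_int j / of_nat (2 * k))" for j
    unfolding U_def V using assms(1) by (simp add: field_simps)
  have odd_vertex: "V (2 * j + 1)
      = c + of_real q * cis ((\<theta> + \<delta>) + 2 * pi * of_int m * of_int j / of_nat (2 * k))" for j
  proof -
    have "\<theta> + 2 * pi * of_int m * of_int (2 * j + 1) / of_nat (4 * k)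
        = (\<theta> + \<delta>) + 2 * pi * of_int m * of_int j / of_nat (2 * k)"
      unfolding \<delta>_def using assms(1) by (simp add: field_simps)
    then show ?thesis
      by (simp only: V) simp
  qed
  have coprime: "coprime m (int (2 * k))"
  proof (rule coprime_if_points_distinct)
    show "c + of_real p * cis (\<theta> + 2 * pi * of_int m * of_int j / of_nat (2 * k))
          \<noteq> c + of_real p * cis \<theta>" if "0 < j" "j < int (2 * k)" for j
      using distinct[of "2 * j"] U[of j] U[of 0] that by (simp add: U_def)
  qed (use assms(1) in simp)
  have "range U = V ` {i. even i}"
    by (auto simp: U_def elim!: evenE)
  then have evens: "equally_spaced_on_circle (2 * k) c p (V ` {i. even i})"
    using equally_spaced_if_coprime_steps[OF _ p coprime, of c \<theta>] assms(1) by (simp add: U[abs_def])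
  have "range (\<lambda>j. V (2 * j + 1)) = V ` {i. odd i}"
    by (auto elim!: oddE)
  then have odds: "equally_spaced_on_circle (2 * k) c q (V ` {i. odd i})"
    using equally_spaced_if_coprime_steps[OF _ q coprime, of c "\<theta> + \<delta>"] assms(1)
    by (simp add: odd_vertex)
  have "regular_polygon (2 * k) U"
    unfolding regular_polygon_def using p coprime U by blast
  moreover have "obtained_by_insertion U ((p * cos \<delta> - q) * sgn (sin \<delta>)) V"
    unfolding obtained_by_insertion_def
  proof (intro allI conjI)
    fix j
    show "V (2 * j) = U j"
      by (simp add: U_def)
    define \<phi> where "\<phi> = \<theta> + 2 * pi * of_int m * of_int j / of_nat (2 * k)"
    have Uj: "U j = c + of_real p * cis \<phi>"
      by (simp add: U \<phi>_def)
    have "\<theta> + 2 * pi * of_int m * of_int (j + 1) / of_nat (2 * k) = \<phi> + 2 * \<delta>"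
      unfolding \<phi>_def \<delta>_def using assms(1) by (simp add: field_simps)
    then have Uj1: "U (j + 1) = c + of_real p * cis (\<phi> + 2 * \<delta>)"
      by (simp only: U)
    have Vj: "V (2 * j + 1) = c + of_real q * cis (\<phi> + \<delta>)"
      unfolding odd_vertex \<phi>_def by (simp add: algebra_simps)
    \<comment> \<open>Otherwise consecutive even vertices would coincide, as \<open>2 * \<delta>\<close> is the angle between them.\<close>
    have "sin \<delta> \<noteq> 0"
    proof
      assume "sin \<delta> = 0"
      then have "cis (2 * \<delta>) = 1"
        by (simp add: complex_eq_iff cos_double_sin sin_double)
      then have "U (j + 1) = U j"
        unfolding Uj Uj1 cis_mult[symmetric] by simp
      then show False
        using polygon_distinct[OF poly, of 2 "2 * j"] assms(1) by (simp add: U_def distrib_left)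
    qed
    from insertion_between_rotated_points[OF p this, where q = q and c = c and \<phi> = \<phi>]
    show "V (2 * j + 1) = midpoint (U j) (U (j + 1))
        + of_real ((p * cos \<delta> - q) * sgn (sin \<delta>)) * (\<i> * sgn (U (j + 1) - U j))"
      unfolding Uj Uj1 Vj by blast
  qed
  ultimately show ?thesis
    using regular evens odds by blast
qed

end
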